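(* Let $m,k\ge1$ and let $A(z)=z^k 1_m-A_1z^{k-1}-\cdots-A_k$ be a matrix polynomial with coefficients $A=[A_1,\dots,A_k]\in\mathbb{R}^{m\times mk}$. Then $A(z)$ is Schur-Stable if and only if there exists a positive definite symmetric block Toeplitz matrix $\underline{U}_{k-1}$ of order $k-1$ with $m\times m$ blocks (so of size $mk\times mk$) such that the Generalized Stein Transform $\tilde S_k(A,\underline{U}_{k-1})$ is positive semi-definite and its upper left block $S_k(A,\underline{U}_{k-1})$ is positive definite.
   Context: All matrices are real; a prime denotes transpose; $1_m$ is the $m\times m$ identity matrix. A matrix polynomial $A(z)=z^k 1_m-A_1z^{k-1}-\cdots-A_k$ is called Schur-Stable if all complex $z$ with $\det(A(z))=0$ satisfy $|z|<1$. A symmetric block Toeplitz matrix $\underline{U}_t$ of order $t$ with $m\times m$ blocks is the $m(t+1)\times m(t+1)$ matrix built from real $m\times m$ matrices $U(0),\dots,U(t)$, $U(0)$ symmetric, whose $(i,j)$ block ($1\le i,j\le t+1$) is $U(j-i)$ if $j\ge i$ and $U(i-j)'$ if $j<i$; in particular $\underline{U}_0=U(0)$. For $A=[A_1,\dots,A_k]\in\mathbb{R}^{m\times mk}$ let $\tilde A$ be the $mk\times mk$ block companion matrix $$\tilde A=\begin{pmatrix}A_1&A_2&\cdots&A_{k-1}&A_k\\ 1_m&0&\cdots&0&0\\ \vdots&&\ddots&&\vdots\\ 0&0&\cdots&1_m&0\end{pmatrix}$$ (with $\tilde A=A_1$ when $k=1$). For a symmetric $mk\times mk$ matrix $\underline{U}$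 with upper left $m\times m$ block $U_{11}$, the Generalized Stein Transform is $$\tilde S_k(A,\underline{U})=\underline{U}-\tilde A\,\underline{U}\,\tilde A',$$ and $S_k(A,\underline{U})=U_{11}-A\,\underline{U}\,A'$ is the upper left $m\times m$ block of $\tilde S_k(A,\underline{U})$. *)

theory Defs
  imports Complex_Main "Jordan_Normal_Form.Determinant"
begin

text \<open>Block indices are zero-based, as in the matrix library: the block called $(i,j)$ in
  one-based notation is block $(i-1,j-1)$ here.\<close>

definition mat_block :: "nat \<Rightarrow> 'a mat \<Rightarrow> nat \<Rightarrow> nat \<Rightarrow> 'a mat" where
  "mat_block m X i j = mat m m (\<lambda>(a, b). X $$ (i * m + a, j * m + b))"

definition mat_of_blocks :: "nat \<Rightarrow> nat \<Rightarrow> nat \<Rightarrow> (nat \<Rightarrow> nat \<Rightarrow> 'a mat) \<Rightarrow> 'a mat" where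
  "mat_of_blocks m p q F =
     mat (m * p) (m * q) (\<lambda>(r, c). F (r div m) (c div m) $$ (r mod m, c mod m))"

text \<open>The coefficient $A_i$, for $1 \le i \le k$, of the block row $A = [A_1, \dots, A_k]$.\<close>

definition coeff_block :: "nat \<Rightarrow> 'a mat \<Rightarrow> nat \<Rightarrow> 'a mat" where
  "coeff_block m A i = mat_block m A 0 (i - 1)"

text \<open>The value $A(z) = z^k 1_m - A_1 z^{k-1} - \dots - A_k$ at a complex point.\<close>

definition mat_poly_eval :: "nat \<Rightarrow> nat \<Rightarrow> real mat \<Rightarrow> complex \<Rightarrow> complex mat" where
  "mat_poly_eval m k A z = mat m m (\<lambda>(a, b).
     z ^ k * (1\<^sub>m m $$ (a, b)) -
     (\<Sum>i = 1..k. complex_of_real (coeff_block m A i $$ (a, b)) * z ^ (k - i)))"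

definition schur_stable :: "nat \<Rightarrow> nat \<Rightarrow> real mat \<Rightarrow> bool" where
  "schur_stable m k A \<longleftrightarrow> (\<forall>z. det (mat_poly_eval m k A z) = 0 \<longrightarrow> cmod z < 1)"

text \<open>Definiteness is understood to include symmetry (hence squareness).\<close>

definition pos_def_mat :: "real mat \<Rightarrow> bool" where
  "pos_def_mat M \<longleftrightarrow> transpose_mat M = M \<and>
     (\<forall>x \<in> carrier_vec (dim_row M). x \<noteq> 0\<^sub>v (dim_row M) \<longrightarrow> scalar_prod x (M *\<^sub>v x) > 0)"

definition pos_semidef_mat :: "real mat \<Rightarrow> bool" where
  "pos_semidef_mat M \<longleftrightarrow> transpose_mat M = M \<and>
     (\<forall>x \<in> carrier_vec (dim_row M). scalar_prod x (M *\<^sub>v x) \<ge> 0)"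

text \<open>Symmetric block Toeplitz matrices of order $t$ have $t + 1$ block rows.\<close>

definition block_toeplitz :: "nat \<Rightarrow> nat \<Rightarrow> (nat \<Rightarrow> real mat) \<Rightarrow> real mat" where
  "block_toeplitz m t V = mat_of_blocks m (t + 1) (t + 1)
     (\<lambda>i j. if i \<le> j then V (j - i) else transpose_mat (V (i - j)))"

definition sym_block_toeplitz :: "nat \<Rightarrow> nat \<Rightarrow> real mat \<Rightarrow> bool" where
  "sym_block_toeplitz m t U \<longleftrightarrow>
     (\<exists>V. (\<forall>s \<le> t. V s \<in> carrier_mat m m) \<and> transpose_mat (V 0) = V 0 \<and>
          U = block_toeplitz m t V)"

definition block_companion :: "nat \<Rightarrow> nat \<Rightarrow> real mat \<Rightarrow> real mat" where
  "block_companion m k A = mat_of_blocks m k k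
     (\<lambda>i j. if i = 0 then coeff_block m A (j + 1)
            else if i = j + 1 then 1\<^sub>m m else 0\<^sub>m m m)"

definition gen_stein_transform :: "nat \<Rightarrow> nat \<Rightarrow> real mat \<Rightarrow> real mat \<Rightarrow> real mat" where
  "gen_stein_transform m k A U =
     U - block_companion m k A * U * transpose_mat (block_companion m k A)"

definition stein_block :: "nat \<Rightarrow> real mat \<Rightarrow> real mat \<Rightarrow> real mat" where
  "stein_block m A U = mat_block m U 0 0 - A * U * transpose_mat A"

lemma row_block_companion:
  assumes "A \<in> carrier_mat m (m * k)" "k \<ge> 1" "a < m"
  shows "row (block_companion m k A) a = row A a"
proof (rule eq_vecI)
  fix j assume "j < dim_vec (row A a)"
  then have j: "j < m * k" using assms by simp
  have m: "m > 0" using assms by simp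
  have d: "a < m * k" using assms by (cases k) auto
  have "j mod m < m" using m by simp
  with d j assms show "row (block_companion m k A) a $ j = row A a $ j"
    by (simp add: block_companion_def mat_of_blocks_def coeff_block_def mat_block_def)
next
  show "dim_vec (row (block_companion m k A) a) = dim_vec (row A a)"
    using assms by (simp add: block_companion_def mat_of_blocks_def)
qed

lemma stein_block_eq_upper_left:
  assumes A: "A \<in> carrier_mat m (m * k)" and k: "k \<ge> 1"
    and U: "U \<in> carrier_mat (m * k) (m * k)"
  shows "stein_block m A U = mat_block m (gen_stein_transform m k A U) 0 0"
proof (rule eq_matI)
  let ?C = "block_companion m k A"
  have C: "?C \<in> carrier_mat (m * k) (m * k)"
    by (simp add: block_companion_def mat_of_blocks_def)
  fix a b
  assume "a < dim_row (mat_block m (gen_stein_transform m k A U) 0 0)"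
    and "b < dim_col (mat_block m (gen_stein_transform m k A U) 0 0)"
  then have ab: "a < m" "b < m" by (auto simp: mat_block_def)
  then have ab': "a < m * k" "b < m * k" using k by (cases k; auto)+
  show "stein_block m A U $$ (a, b) = mat_block m (gen_stein_transform m k A U) 0 0 $$ (a, b)"
    using ab ab' A C U row_block_companion[OF A k ab(1)] row_block_companion[OF A k ab(2)]
    by (simp add: stein_block_def gen_stein_transform_def mat_block_def)
qed (use A in \<open>auto simp: stein_block_def mat_block_def\<close>)

end

theory Submission
  imports Defs "Jordan_Normal_Form.Spectral_Radius"
begin

text \<open>
  Write \<open>B\<close> for the block companion matrix. The block Toeplitz property of \<open>U\<close> says exactly
  that \<open>U - B U B'\<close> vanishes outside its first block row and column. For sufficiency, positive
  semidefiniteness then reduces \<open>U - B U B'\<close> to its leading block \<open>S\<close>; a left eigenvector \<open>x\<close> of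
  \<open>B\<close> with eigenvalue \<open>z\<close> satisfies \<open>(1 - |z|\<^sup>2) x* U x = x\<^sub>1* S x\<^sub>1\<close>, so \<open>|z| \<ge> 1\<close> would force
  \<open>x\<^sub>1 = 0\<close>, and a left eigenvector with zero leading block vanishes. For necessity, the series
  \<open>U = \<Sum>i. B^i E (B^i)'\<close> with \<open>E = diag(1, 0, \<dots>, 0)\<close> converges and solves \<open>U - B U B' = E\<close>;
  it is therefore block Toeplitz, and it is positive definite by the same observability argument.
\<close>

section \<open>Coordinate formulas for matrix-vector products and quadratic forms\<close>

lemma index_mult_mat_vec_sum:
  assumes "M \<in> carrier_mat n p" "x \<in> carrier_vec p" "i < n"
  shows "(M *\<^sub>v x) $ i = (\<Sum>j<p. M $$ (i, j) * x $ j)"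
  using assms by (auto simp: scalar_prod_def atLeast0LessThan intro!: sum.cong)

lemma quadratic_form_sum:
  assumes "M \<in> carrier_mat n n" "x \<in> carrier_vec n"
  shows "x \<bullet> (M *\<^sub>v x) = (\<Sum>i<n. \<Sum>j<n. x $ i * M $$ (i, j) * x $ j)"
proof -
  have "x \<bullet> (M *\<^sub>v x) = (\<Sum>i<n. x $ i * (M *\<^sub>v x) $ i)"
    using assms by (auto simp: scalar_prod_def atLeast0LessThan)
  also have "\<dots> = (\<Sum>i<n. \<Sum>j<n. x $ i * M $$ (i, j) * x $ j)"
    using assms by (intro sum.cong refl)
      (simp add: index_mult_mat_vec_sum[OF assms] sum_distrib_left mult.assoc del: index_mult_mat_vec)
  finally show ?thesis .
qed

section \<open>Entries of the block companion matrix, and observability\<close>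

lemma block_companion_carrier [simp]:
  "block_companion m k A \<in> carrier_mat (m * k) (m * k)"
  by (simp add: block_companion_def mat_of_blocks_def)

lemma block_companion_dim [simp]:
  "dim_row (block_companion m k A) = m * k" "dim_col (block_companion m k A) = m * k"
  by (simp_all add: block_companion_def mat_of_blocks_def)

lemma transpose_block_companion_mult_vec_carrier [simp]:
  "(block_companion m k A)\<^sup>T *\<^sub>v x \<in> carrier_vec (m * k)"
  by (rule carrier_vecI) simp

text \<open>In flat indices the identity blocks form one diagonal at distance \<open>m\<close> below
  the main diagonal, which removes \<open>div\<close> and \<open>mod\<close> from entry
  computations.\<close>

lemma index_block_companion:
  assumes "m > 0" "r < m * k" "c < m * k"
  shows "block_companion m k A $$ (r, c) =
    (if r < m then A $$ (r, c) else if r = c + m then 1 else 0)"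
proof -
  have b: "r mod m < m" "c mod m < m" using assms by auto
  show ?thesis
  proof (cases "r < m")
    case True
    then show ?thesis using assms b
      by (simp add: block_companion_def mat_of_blocks_def coeff_block_def mat_block_def)
  next
    case False
    then have "r div m \<noteq> 0" using assms by (simp add: div_eq_0_iff)
    moreover have "r = c + m \<longleftrightarrow> r div m = Suc (c div m) \<and> r mod m = c mod m" 
    proof
      assume "r = c + m" then show "r div m = Suc (c div m) \<and> r mod m = c mod m" using assms by simp
    next
      assume "r div m = Suc (c div m) \<and> r mod m = c mod m"
      then have "r div m * m + r mod m = Suc (c div m) * m + c mod m" by simp
      then show "r = c + m" using div_mult_mod_eq[of r m] div_mult_mod_eq[of c m] by simp
    qed
    ultimately show ?thesis using assms b False
      by (auto simp add: block_companion_def mat_of_blocks_def)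
  qed
qed

lemma index_transpose_block_companion_mult_vec:
  assumes "m > 0" "k > 0" "x \<in> carrier_vec (m * k)" "c < m * k"
  shows "((block_companion m k A)\<^sup>T *\<^sub>v x) $ c =
    (\<Sum>a<m. A $$ (a, c) * x $ a) + (if c + m < m * k then x $ (c + m) else 0)"
proof -
  let ?n = "m * k"
  let ?g = "\<lambda>r. (if r < m then A $$ (r, c) else if r = c + m then 1 else 0) * x $ r"
  have mk: "m \<le> ?n" using assms(1,2) by (cases k) auto
  have "((block_companion m k A)\<^sup>T *\<^sub>v x) $ c = (\<Sum>r<?n. (block_companion m k A)\<^sup>T $$ (c, r) * x $ r)"
    by (rule index_mult_mat_vec_sum) (use assms in auto)
  also have "\<dots> = sum ?g {..<?n}"
    using assms by (intro sum.cong) (auto simp: index_block_companion)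
  also have "{..<?n} = {..<m} \<union> {m..<?n}" by (rule ivl_disj_un_one(2)[OF mk, symmetric])
  also have "sum ?g ({..<m} \<union> {m..<?n}) = sum ?g {..<m} + sum ?g {m..<?n}"
    by (rule sum.union_disjoint) auto
  also have "sum ?g {m..<?n} = (\<Sum>r\<in>{m..<?n}. if r = c + m then x $ r else 0)"
    by (intro sum.cong) auto
  also have "\<dots> = (if c + m < ?n then x $ (c + m) else 0)"
    by (subst sum.delta) auto
  finally show ?thesis by simp
qed

text \<open>Observability: on vectors with vanishing leading block, the transposed companion matrix
  acts as the shift of blocks.\<close>

lemma block_companion_observable:
  assumes "m > 0" "k > 0" and W: "W \<subseteq> carrier_vec (m * k)"
    and W0: "\<And>x a. x \<in> W \<Longrightarrow> a < m \<Longrightarrow> x $ a = (0 :: real)"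
    and inv: "\<And>x. x \<in> W \<Longrightarrow> (block_companion m k A)\<^sup>T *\<^sub>v x \<in> W"
    and "x \<in> W"
  shows "x = 0\<^sub>v (m * k)"
proof (rule eq_vecI)
  \<comment> \<open>The induction on the entry index covers all of \<open>W\<close> at once, because
    its step passes from \<open>x\<close> to the image of \<open>x\<close>: entry
    \<open>c - m\<close> of the image is entry \<open>c\<close> of \<open>x\<close>.\<close>
  have "\<forall>x\<in>W. c < m * k \<longrightarrow> x $ c = 0" for c
  proof (induction c rule: less_induct)
    case (less c)
    show ?case
    proof (intro ballI impI)
      fix x assume x: "x \<in> W" and c: "c < m * k"
      show "x $ c = 0"
      proof (cases "c < m")
        case True then show ?thesis using W0 x by simp
      next
        case False
        then have "((block_companion m k A)\<^sup>T *\<^sub>v x) $ (c - m) = 0"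
          using less.IH[of "c - m"] inv[OF x] assms(1) c by simp
        moreover have "((block_companion m k A)\<^sup>T *\<^sub>v x) $ (c - m) = x $ c"
          by (subst index_transpose_block_companion_mult_vec[OF assms(1,2)])
            (use W x c False W0[OF x] in auto)
        ultimately show ?thesis by simp
      qed
    qed
  qed
  then show "x $ i = 0\<^sub>v (m * k) $ i" if "i < dim_vec (0\<^sub>v (m * k))" for i
    using that \<open>x \<in> W\<close> by simp
qed (use W \<open>x \<in> W\<close> in auto)

section \<open>Block Toeplitz structure as shift invariance, and the Stein transform\<close>

lemma block_toeplitz_carrier [simp]:
  "k > 0 \<Longrightarrow> block_toeplitz m (k - 1) V \<in> carrier_mat (m * k) (m * k)"
  by (simp add: block_toeplitz_def mat_of_blocks_def)

lemma sym_block_toeplitz_shift: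
  assumes "m > 0" "k > 0" "sym_block_toeplitz m (k - 1) U" "r + m < m * k" "c + m < m * k"
  shows "U $$ (r + m, c + m) = U $$ (r, c)"
  using assms by (auto simp: sym_block_toeplitz_def block_toeplitz_def mat_of_blocks_def)

text \<open>The blocks \<open>V s\<close> are read off the first block row. An entry on or above the
  block diagonal is moved back along its diagonal, \<open>m\<close> places at a time, until it lies
  in that row; below the block diagonal, symmetry first replaces it by its mirror image.\<close>

lemma sym_block_toeplitzI:
  assumes m: "m > 0" and k: "k > 0" and U: "U \<in> carrier_mat (m * k) (m * k)" and sym: "U\<^sup>T = U"
    and shift: "\<And>r c. r + m < m * k \<Longrightarrow> c + m < m * k \<Longrightarrow> U $$ (r + m, c + m) = U $$ (r, c)"
  shows "sym_block_toeplitz m (k - 1) U"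
proof -
  have sym': "U $$ (r, c) = U $$ (c, r)" if "r < m * k" "c < m * k" for r c
    using that U sym by (metis carrier_matD index_transpose_mat(1))
  have shift': "U $$ (r + i * m, c + i * m) = U $$ (r, c)"
    if "r + i * m < m * k" "c + i * m < m * k" for i r c
    using that
  proof (induction i)
    case (Suc i)
    have "U $$ (r + Suc i * m, c + Suc i * m) = U $$ ((r + i * m) + m, (c + i * m) + m)"
      by (simp add: algebra_simps)
    also have "\<dots> = U $$ (r + i * m, c + i * m)"
      using Suc.prems by (intro shift) (simp_all add: algebra_simps)
    also have "\<dots> = U $$ (r, c)" using Suc by simp
    finally show ?case .
  qed simp
  define V where "V s = mat_block m U 0 s" for s
  have bound: "j * m + b < m * k" if "j < k" "b < m" for j b
    using mult_le_mono1[of "Suc j" k m] that by (simp add: mult.commute)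
  have ind: "U $$ (r, c) = block_toeplitz m (k - 1) V $$ (r, c)"
    if r: "r < m * k" and c: "c < m * k" for r c
  proof -
    let ?i = "r div m" and ?j = "c div m" and ?a = "r mod m" and ?b = "c mod m"
    have ab: "?a < m" "?b < m" using m by auto
    have ij: "?i < k" "?j < k" using r c m by (simp_all add: less_mult_imp_div_less mult.commute)
    show ?thesis
    proof (cases "?i \<le> ?j")
      case True
      have cc: "((?j - ?i) * m + ?b) + ?i * m = c"
        using True by (metis add.assoc add.commute add_mult_distrib div_mult_mod_eq le_add_diff_inverse2)
      have rr: "?a + ?i * m = r" by simp
      have "U $$ (r, c) = U $$ (?a, (?j - ?i) * m + ?b)"
        using shift'[of ?a ?i "(?j - ?i) * m + ?b"] r c unfolding cc rr by simp
      then show ?thesis using True r c ab k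
        by (simp add: block_toeplitz_def mat_of_blocks_def V_def mat_block_def)
    next
      case False
      have rr: "((?i - ?j) * m + ?a) + ?j * m = r"
        using False by (metis add.assoc add.commute add_mult_distrib div_mult_mod_eq le_add_diff_inverse2 nat_le_linear)
      have cc: "?b + ?j * m = c" by simp
      have "U $$ (c, r) = U $$ (?b, (?i - ?j) * m + ?a)"
        using shift'[of ?b ?j "(?i - ?j) * m + ?a"] r c unfolding cc rr by simp
      then show ?thesis using False r c ab k sym'[OF r c]
        by (simp add: block_toeplitz_def mat_of_blocks_def V_def mat_block_def)
    qed
  qed
  have "(V 0)\<^sup>T = V 0"
  proof (rule eq_matI)
    fix a b assume "a < dim_row (V 0)" "b < dim_col (V 0)"
    then have "a < m" "b < m" by (auto simp: V_def mat_block_def)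
    then show "(V 0)\<^sup>T $$ (a, b) = V 0 $$ (a, b)"
      using sym'[of a b] bound[of 0 a] bound[of 0 b] k by (simp add: V_def mat_block_def)
  qed (auto simp: V_def mat_block_def)
  moreover have "U = block_toeplitz m (k - 1) V"
    by (rule eq_matI) (use ind U k block_toeplitz_carrier[of k m V] in \<open>auto simp del: block_toeplitz_carrier\<close>)
  moreover have "\<forall>s \<le> k - 1. V s \<in> carrier_mat m m" by (simp add: V_def mat_block_def)
  ultimately show ?thesis unfolding sym_block_toeplitz_def by blast
qed

text \<open>Rows of the companion matrix past the first \<open>m\<close> are unit vectors, so
  \<open>B U B'\<close> contains a copy of \<open>U\<close> moved one block down and one block
  right. For symmetric \<open>U\<close>, being block Toeplitz thus means that the difference
  vanishes at all these positions.\<close>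

lemma index_gen_stein_transform_shift:
  assumes "m > 0" "k > 0" and U: "U \<in> carrier_mat (m * k) (m * k)"
    and "r + m < m * k" "c + m < m * k"
  shows "gen_stein_transform m k A U $$ (r + m, c + m) = U $$ (r + m, c + m) - U $$ (r, c)"
proof -
  let ?n = "m * k" and ?B = "block_companion m k A"
  \<comment> \<open>Row \<open>r + m\<close> of \<open>?B\<close> is the unit vector at
    \<open>r\<close>; the same fact is used below for the columns of the transpose.\<close>
  have r: "(?B * U) $$ (r + m, j) = U $$ (r, j)" if "j < ?n" for j
  proof -
    have "(?B * U) $$ (r + m, j) = (\<Sum>i<?n. ?B $$ (r + m, i) * U $$ (i, j))"
      using assms that by (auto simp: scalar_prod_def atLeast0LessThan intro!: sum.cong)
    also have "\<dots> = (\<Sum>i<?n. if i = r then U $$ (r, j) else 0)"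
      using assms by (intro sum.cong) (auto simp: index_block_companion)
    also have "\<dots> = U $$ (r, j)" using assms by simp
    finally show ?thesis .
  qed
  have "(?B * U * ?B\<^sup>T) $$ (r + m, c + m) = (\<Sum>j<?n. (?B * U) $$ (r + m, j) * ?B $$ (c + m, j))"
    using assms by (auto simp: scalar_prod_def atLeast0LessThan intro!: sum.cong simp del: index_mult_mat(1)
      simp: index_mult_mat(1)[of _ "?B * U" _ "?B\<^sup>T"])
  also have "\<dots> = (\<Sum>j<?n. if j = c then U $$ (r, c) else 0)"
    using assms by (intro sum.cong refl) (auto simp: index_block_companion r simp del: index_mult_mat(1))
  also have "\<dots> = U $$ (r, c)" using assms by simp
  finally show ?thesis using assms by (simp add: gen_stein_transform_def del: index_mult_mat(1))
qed

section \<open>Eigenvalues of the companion matrix as zeros of the determinant\<close>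

lemma sum_block_index:
  fixes f :: "nat \<Rightarrow> 'a :: comm_monoid_add"
  shows "(\<Sum>c<m * k. f c) = (\<Sum>j<k. \<Sum>b<m. f (j * m + b))"
proof -
  have "sum f {i * m..<i * m + m} = (\<Sum>b<m. f (i * m + b))" for i
    using sum.shift_bounds_nat_ivl[of f 0 "i * m" m] by (simp add: atLeast0LessThan add.commute)
  then show ?thesis
    using sum.nat_group[of f m k] by (simp add: mult.commute)
qed

lemma mult_vec_mat_poly_eval:
  assumes "w \<in> carrier_vec m" "a < m"
  shows "(mat_poly_eval m k A z *\<^sub>v w) $ a = z ^ k * w $ a -
    (\<Sum>j<k. \<Sum>b<m. complex_of_real (A $$ (a, j * m + b)) * z ^ (k - 1 - j) * w $ b)"
proof -
  have "(mat_poly_eval m k A z *\<^sub>v w) $ a = (\<Sum>b<m. mat_poly_eval m k A z $$ (a, b) * w $ b)"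
    by (rule index_mult_mat_vec_sum) (use assms in \<open>auto simp: mat_poly_eval_def\<close>)
  also have "\<dots> = (\<Sum>b<m. (if b = a then z ^ k * w $ a else 0) -
    (\<Sum>j<k. complex_of_real (A $$ (a, j * m + b)) * z ^ (k - 1 - j) * w $ b))"
  proof (rule sum.cong, goal_cases)
    case (2 b)
    \<comment> \<open>The substitution i = j + 1 passes to zero-based block columns and turns the
      exponent \<open>k - i\<close> into \<open>k - 1 - j\<close>.\<close>
    have "(\<Sum>i = 1..k. complex_of_real (coeff_block m A i $$ (a, b)) * z ^ (k - i)) =
      (\<Sum>j<k. complex_of_real (A $$ (a, j * m + b)) * z ^ (k - 1 - j))"
      by (rule sum.reindex_bij_witness[of _ Suc "\<lambda>i. i - 1"])
        (use 2 assms in \<open>auto simp: coeff_block_def mat_block_def\<close>)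
    then show ?case using 2 assms
      by (auto simp: mat_poly_eval_def sum_distrib_right left_diff_distrib)
  qed simp
  also have "\<dots> = z ^ k * w $ a -
    (\<Sum>b<m. \<Sum>j<k. complex_of_real (A $$ (a, j * m + b)) * z ^ (k - 1 - j) * w $ b)"
    using assms by (simp add: sum_subtractf)
  also have "(\<Sum>b<m. \<Sum>j<k. complex_of_real (A $$ (a, j * m + b)) * z ^ (k - 1 - j) * w $ b) =
    (\<Sum>j<k. \<Sum>b<m. complex_of_real (A $$ (a, j * m + b)) * z ^ (k - 1 - j) * w $ b)"
    by (rule sum.swap)
  finally show ?thesis .
qed

lemma index_complex_block_companion_mult_vec:
  fixes v :: "complex vec"
  assumes "m > 0" "k > 0" "v \<in> carrier_vec (m * k)" "r < m * k"
  shows "(map_mat complex_of_real (block_companion m k A) *\<^sub>v v) $ r =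
    (if r < m then \<Sum>j<k. \<Sum>b<m. complex_of_real (A $$ (r, j * m + b)) * v $ (j * m + b)
     else v $ (r - m))"
proof -
  have "(map_mat complex_of_real (block_companion m k A) *\<^sub>v v) $ r =
    (\<Sum>c<m * k. map_mat complex_of_real (block_companion m k A) $$ (r, c) * v $ c)"
    by (rule index_mult_mat_vec_sum) (use assms in auto)
  also have "\<dots> = (\<Sum>c<m * k. if r < m then complex_of_real (A $$ (r, c)) * v $ c
      else if c = r - m then v $ c else 0)"
    using assms by (intro sum.cong) (auto simp: index_block_companion)
  also have "\<dots> = (if r < m then \<Sum>c<m * k. complex_of_real (A $$ (r, c)) * v $ c else v $ (r - m))"
    using assms by auto
  finally show ?thesis by (simp only: sum_block_index)
qed

text \<open>Right eigenvectors of the block companion matrix are the stacked vectors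
  $(z^{k-1} w, \dots, z w, w)$ with $A(z) w = 0$.\<close>

lemma eigenvalue_block_companion_iff:
  assumes m: "m > 0" and k: "k > 0"
  shows "eigenvalue (map_mat complex_of_real (block_companion m k A)) z \<longleftrightarrow>
    det (mat_poly_eval m k A z) = 0"
proof -
  let ?n = "m * k" and ?B = "map_mat complex_of_real (block_companion m k A)"
  let ?P = "mat_poly_eval m k A z"
  have P: "?P \<in> carrier_mat m m" by (simp add: mat_poly_eval_def)
  have bound: "j * m + b < m * k" if "j < k" "b < m" for j b
    using mult_le_mono1[of "Suc j" k m] that by (simp add: mult.commute)
  have zpow: "z * z ^ (k - 1) = z ^ k" using k by (cases k) auto
  show ?thesis
  proof
    assume "eigenvalue ?B z"
    then obtain v where v: "v \<in> carrier_vec ?n" "v \<noteq> 0\<^sub>v ?n" and ev: "?B *\<^sub>v v = z \<cdot>\<^sub>v v"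
      unfolding eigenvalue_def eigenvector_def by auto
    have evi: "(?B *\<^sub>v v) $ r = z * v $ r" if "r < ?n" for r using ev v that by simp
    \<comment> \<open>The last block of \<open>v\<close>. Past the leading block, the eigenvector
      equation says that each block is \<open>z\<close> times the next one, so all of
      \<open>v\<close> is recovered from \<open>w\<close> by going upwards; the leading block of the
      equation then becomes A(z) w = 0.\<close>
    define w where "w = vec m (\<lambda>b. v $ ((k - 1) * m + b))"
    have vw: "v $ (j * m + b) = z ^ (k - 1 - j) * w $ b" if "j < k" "b < m" for j b
    proof -
      have "v $ ((k - 1 - i) * m + b) = z ^ i * w $ b" if "i < k" for i
        using that
      proof (induction i)
        case 0 then show ?case using \<open>b < m\<close> by (simp add: w_def)
      next
        case (Suc i)
        let ?r = "(k - 1 - i) * m + b"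
        have e: "k - 1 - i = Suc (k - 1 - Suc i)" using Suc.prems by simp
        have r: "?r \<ge> m" "?r - m = (k - 1 - Suc i) * m + b" unfolding e by simp_all
        have "v $ (?r - m) = z * v $ ?r"
          using evi[of ?r] index_complex_block_companion_mult_vec[OF m k v(1), of ?r A]
            bound[of "k - 1 - i" b] \<open>b < m\<close> r(1) k by simp
        then show ?case using Suc unfolding r(2) by simp
      qed
      from this[of "k - 1 - j"] that show ?thesis by simp
    qed
    have "?P *\<^sub>v w = 0\<^sub>v m"
    proof (rule eq_vecI)
      fix a assume "a < dim_vec (0\<^sub>v m :: complex vec)"
      then have a: "a < m" by simp
      have "a < ?n" using bound[of 0 a] a k by simp
      then have "z * v $ a = (\<Sum>j<k. \<Sum>b<m. complex_of_real (A $$ (a, j * m + b)) * v $ (j * m + b))"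
        using evi index_complex_block_companion_mult_vec[OF m k v(1), of a A] a by simp
      also have "v $ a = z ^ (k - 1) * w $ a" using vw[of 0 a] k a by simp
      also have "(\<Sum>j<k. \<Sum>b<m. complex_of_real (A $$ (a, j * m + b)) * v $ (j * m + b)) =
        (\<Sum>j<k. \<Sum>b<m. complex_of_real (A $$ (a, j * m + b)) * z ^ (k - 1 - j) * w $ b)"
        by (intro sum.cong refl) (simp add: vw)
      finally show "(?P *\<^sub>v w) $ a = 0\<^sub>v m $ a"
        using a zpow by (subst mult_vec_mat_poly_eval) (auto simp: w_def mult.assoc[symmetric])
    qed (use P in simp)
    moreover have "w \<noteq> 0\<^sub>v m"
    proof
      assume w0: "w = 0\<^sub>v m"
      have "v = 0\<^sub>v ?n"
      proof (rule eq_vecI)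
        fix c assume "c < dim_vec (0\<^sub>v ?n :: complex vec)"
        then have "c div m < k" "c mod m < m" using m by (auto simp: less_mult_imp_div_less mult.commute)
        from vw[OF this] show "v $ c = 0\<^sub>v ?n $ c"
          using w0 \<open>c mod m < m\<close> \<open>c < dim_vec (0\<^sub>v ?n :: complex vec)\<close> by simp
      qed (use v in simp)
      with v show False by simp
    qed
    moreover have "w \<in> carrier_vec m" by (simp add: w_def)
    ultimately show "det ?P = 0" using det_0_iff_vec_prod_zero[OF P] by blast
  next
    assume "det ?P = 0"
    then obtain w where w: "w \<in> carrier_vec m" "w \<noteq> 0\<^sub>v m" "?P *\<^sub>v w = 0\<^sub>v m"
      using det_0_iff_vec_prod_zero[OF P] by blast
    define v where "v = vec ?n (\<lambda>c. z ^ (k - 1 - c div m) * w $ (c mod m))"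
    have v: "v \<in> carrier_vec ?n" by (simp add: v_def)
    have vw: "v $ (j * m + b) = z ^ (k - 1 - j) * w $ b" if "j < k" "b < m" for j b
      using that bound[OF that] by (simp add: v_def)
    have "?B *\<^sub>v v = z \<cdot>\<^sub>v v"
    proof (rule eq_vecI)
      fix r assume "r < dim_vec (z \<cdot>\<^sub>v v)"
      then have r: "r < ?n" by (simp add: v_def)
      show "(?B *\<^sub>v v) $ r = (z \<cdot>\<^sub>v v) $ r"
      proof (cases "r < m")
        case True
        have "(?P *\<^sub>v w) $ r = 0" using w True by simp
        then have "z ^ k * w $ r =
          (\<Sum>j<k. \<Sum>b<m. complex_of_real (A $$ (r, j * m + b)) * z ^ (k - 1 - j) * w $ b)"
          using mult_vec_mat_poly_eval[OF w(1) True, of k A z] by simp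
        also have "\<dots> = (\<Sum>j<k. \<Sum>b<m. complex_of_real (A $$ (r, j * m + b)) * v $ (j * m + b))"
          by (intro sum.cong refl) (simp add: vw)
        also have "\<dots> = (?B *\<^sub>v v) $ r"
          using index_complex_block_companion_mult_vec[OF m k v r, of A] True by simp
        finally show ?thesis using vw[of 0 r] True k r v zpow
          by (simp add: mult.assoc[symmetric] del: index_mult_mat_vec)
      next
        case False
        have d: "r div m = Suc ((r - m) div m)" "r mod m = (r - m) mod m"
          using False m by (simp_all add: le_div_geq le_mod_geq)
        have "r div m < k" using r by (simp add: less_mult_imp_div_less mult.commute)
        then have "z ^ (k - 1 - (r - m) div m) = z * z ^ (k - 1 - r div m)"
          unfolding d(1) by (simp flip: power_Suc add: Suc_diff_Suc)
        moreover have "(?B *\<^sub>v v) $ r = v $ (r - m)"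
          using index_complex_block_companion_mult_vec[OF m k v r, of A] False by simp
        ultimately show ?thesis using r d(2) by (simp add: v_def del: index_mult_mat_vec)
      qed
    qed (simp add: v_def)
    \<comment> \<open>The last block of \<open>v\<close> carries the factor \<open>z ^ 0\<close>, so
      it equals \<open>w\<close> even when \<open>z = 0\<close>.\<close>
    moreover have "v \<noteq> 0\<^sub>v ?n"
    proof
      assume v0: "v = 0\<^sub>v ?n"
      have "w = 0\<^sub>v m"
      proof (rule eq_vecI)
        fix b assume "b < dim_vec (0\<^sub>v m :: complex vec)"
        then show "w $ b = 0\<^sub>v m $ b" using vw[of "k - 1" b] v0 k bound[of "k - 1" b] by simp
      qed (use w in simp)
      with w show False by simp
    qed
    ultimately show "eigenvalue ?B z" using v unfolding eigenvalue_def eigenvector_def by auto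
  qed
qed

section \<open>Geometric decay of matrix powers\<close>

lemma smult_pow_mat:
  fixes M :: "'a :: comm_ring_1 mat"
  assumes M: "M \<in> carrier_mat n n"
  shows "(c \<cdot>\<^sub>m M) ^\<^sub>m i = c ^ i \<cdot>\<^sub>m (M ^\<^sub>m i)"
proof (induction i)
  case (Suc i)
  have "c ^ i \<cdot>\<^sub>m M ^\<^sub>m i * (c \<cdot>\<^sub>m M) = (c * c ^ i) \<cdot>\<^sub>m (M ^\<^sub>m i * M)"
    using M pow_carrier_mat[OF M, of i]
    by (intro eq_matI) (auto simp: mult.commute)
  with Suc show ?case by simp
qed (use M in auto)

text \<open>Dividing \<open>M\<close> by a number \<open>q\<close> strictly between its spectral
  radius and 1 leaves the spectral radius below 1, so the powers of the scaled matrix are bounded;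
  scaling back produces the factor \<open>q ^ i\<close>.\<close>

lemma pow_mat_geometric_bound:
  fixes M :: "complex mat"
  assumes M: "M \<in> carrier_mat n n" and n: "n > 0"
    and ev: "\<And>z. eigenvalue M z \<Longrightarrow> cmod z < 1"
  shows "\<exists>C q. 0 < q \<and> q < 1 \<and> (\<forall>i r c. r < n \<longrightarrow> c < n \<longrightarrow> cmod ((M ^\<^sub>m i) $$ (r, c)) \<le> C * q ^ i)"
proof -
  have sr: "spectral_radius M < 1" "spectral_radius M \<ge> 0"
    using spectral_radius_mem_max(1)[OF M n] ev by (auto simp: spectrum_def)
  \<comment> \<open>The midpoint between the spectral radius and 1 is positive even if the spectral
    radius is zero, so division by \<open>q\<close> is safe.\<close>
  define q where "q = (1 + spectral_radius M) / 2"
  have q: "0 < q" "q < 1" "spectral_radius M < q" using sr by (auto simp: q_def)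
  define N where "N = complex_of_real (1 / q) \<cdot>\<^sub>m M"
  have N: "N \<in> carrier_mat n n" using M by (simp add: N_def)
  have "spectral_radius N < 1"
  proof -
    obtain z where z: "eigenvalue N z" "spectral_radius N = cmod z"
      using spectral_radius_mem_max(1)[OF N n] by (auto simp: spectrum_def)
    then obtain v where v: "v \<in> carrier_vec n" "v \<noteq> 0\<^sub>v n" "N *\<^sub>v v = z \<cdot>\<^sub>v v"
      using N unfolding eigenvalue_def eigenvector_def by auto
    have "M *\<^sub>v v = complex_of_real q \<cdot>\<^sub>v (N *\<^sub>v v)"
      using M v(1) q by (intro eq_vecI) (auto simp: N_def)
    then have "eigenvalue M (complex_of_real q * z)"
      using v M unfolding eigenvalue_def eigenvector_def by (auto simp: smult_smult_assoc)
    then have "cmod (complex_of_real q * z) \<le> spectral_radius M"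
      by (intro spectral_radius_mem_max(2)[OF M n]) (auto simp: spectrum_def)
    then have "q * cmod z \<le> spectral_radius M" using q(1) by (simp add: norm_mult)
    then have "q * cmod z < q * 1" using q(3) by linarith
    then show ?thesis using q(1) z(2) by (simp only: mult_less_cancel_left_pos)
  qed
  then obtain C where C: "\<And>i. norm_bound (N ^\<^sub>m i) C"
    using spectral_radius_jnf_norm_bound_less_1_upper_triangular[OF N] by blast
  have "cmod ((M ^\<^sub>m i) $$ (r, c)) \<le> C * q ^ i" if "r < n" "c < n" for i r c
  proof -
    have "complex_of_real q \<cdot>\<^sub>m N = M" using q(1) M by (intro eq_matI) (auto simp: N_def)
    then have "M ^\<^sub>m i = complex_of_real q ^ i \<cdot>\<^sub>m N ^\<^sub>m i" using smult_pow_mat[OF N] by metis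
    then have "(M ^\<^sub>m i) $$ (r, c) = complex_of_real q ^ i * (N ^\<^sub>m i) $$ (r, c)"
      using that N by simp
    moreover have "cmod ((N ^\<^sub>m i) $$ (r, c)) \<le> C"
      using C[of i] that N by (simp add: norm_bound_def)
    ultimately show ?thesis
      using q(1) by (simp add: norm_mult norm_power mult.commute mult_right_mono)
  qed
  then show ?thesis using q by blast
qed

section \<open>Sufficiency: a Stein certificate implies stability\<close>

text \<open>With a zero diagonal entry at \<open>c\<close>, the form at \<open>t\<close> times the
  unit vector \<open>r\<close> plus the unit vector \<open>c\<close> has no constant term in
  \<open>t\<close>. A nonzero linear term would make it negative for small \<open>t\<close> of
  suitable sign.\<close>

lemma pos_semidef_diag_zero:
  assumes Q: "pos_semidef_mat Q" "Q \<in> carrier_mat n n" and rc: "r < n" "c < n" and zero: "Q $$ (c, c) = 0"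
  shows "Q $$ (r, c) = 0"
proof (rule ccontr)
  assume nz: "Q $$ (r, c) \<noteq> 0"
  with zero have "r \<noteq> c" by auto
  have "Q\<^sup>T $$ (c, r) = Q $$ (r, c)" using Q rc by simp
  then have sym: "Q $$ (c, r) = Q $$ (r, c)" using Q by (simp add: pos_semidef_mat_def)
  have form: "0 \<le> t * (t * Q $$ (r, r) + 2 * Q $$ (r, c))" for t
  proof -
    define x where "x = vec n (\<lambda>i. (if i = r then t else 0) + (if i = c then 1 else 0))"
    have x: "x \<in> carrier_vec n" by (simp add: x_def)
    have row: "(\<Sum>j<n. x $ i * Q $$ (i, j) * x $ j) = x $ i * (t * Q $$ (i, r) + Q $$ (i, c))" for i
    proof -
      have "(\<Sum>j<n. x $ i * Q $$ (i, j) * x $ j) =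
        (\<Sum>j<n. (if j = r then x $ i * Q $$ (i, r) * t else 0) + (if j = c then x $ i * Q $$ (i, c) else 0))"
        by (intro sum.cong) (auto simp: x_def algebra_simps)
      also have "\<dots> = x $ i * Q $$ (i, r) * t + x $ i * Q $$ (i, c)"
        using rc by (simp add: sum.distrib)
      finally show ?thesis by (simp add: algebra_simps)
    qed
    have "x \<bullet> (Q *\<^sub>v x) = (\<Sum>i<n. x $ i * (t * Q $$ (i, r) + Q $$ (i, c)))"
      unfolding quadratic_form_sum[OF Q(2) x] row ..
    also have "\<dots> = (\<Sum>i<n. (if i = r then t * (t * Q $$ (r, r) + Q $$ (r, c)) else 0) +
        (if i = c then t * Q $$ (c, r) + Q $$ (c, c) else 0))"
      using \<open>r \<noteq> c\<close> by (intro sum.cong) (auto simp: x_def)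
    also have "\<dots> = t * (t * Q $$ (r, r) + Q $$ (r, c)) + (t * Q $$ (c, r) + Q $$ (c, c))"
      using rc by (simp add: sum.distrib)
    also have "\<dots> = t * (t * Q $$ (r, r) + 2 * Q $$ (r, c))"
      using sym zero by (simp add: algebra_simps)
    finally have "x \<bullet> (Q *\<^sub>v x) = t * (t * Q $$ (r, r) + 2 * Q $$ (r, c))" .
    moreover have "x \<bullet> (Q *\<^sub>v x) \<ge> 0" using Q x by (auto simp: pos_semidef_mat_def)
    ultimately show ?thesis by simp
  qed
  let ?a = "Q $$ (r, r)" and ?b = "Q $$ (r, c)"
  have a: "?a \<ge> 0" using form[of 1] form[of "-1"] by simp
  \<comment> \<open>An explicit \<open>t\<close> violating \<open>form\<close>; the denominator
    \<open>?a + 1\<close> rather than \<open>?a\<close> also covers \<open>?a = 0\<close>.\<close>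
  have "- ?b / (?a + 1) * (- ?b / (?a + 1) * ?a + 2 * ?b) = - (?b\<^sup>2 * (?a + 2) / (?a + 1)\<^sup>2)"
    using a by (simp add: divide_simps power2_eq_square) (simp add: algebra_simps)
  moreover have "?b\<^sup>2 * (?a + 2) / (?a + 1)\<^sup>2 > 0"
    using a nz by (intro divide_pos_pos mult_pos_pos) auto
  ultimately show False using form[of "- ?b / (?a + 1)"] by linarith
qed

lemma gen_stein_transform_carrier [simp]:
  "gen_stein_transform m k A U \<in> carrier_mat (m * k) (m * k)"
  by (simp add: gen_stein_transform_def carrier_matI)

lemma gen_stein_transform_dim [simp]:
  "dim_row (gen_stein_transform m k A U) = m * k" "dim_col (gen_stein_transform m k A U) = m * k"
  by (simp_all add: gen_stein_transform_def)

text \<open>The Toeplitz property makes the diagonal of the Stein transform vanish past the first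
  block, and semidefiniteness then kills the whole rows and columns there. What remains of the form
  at \<open>x\<close> is the form of \<open>stein_block\<close> at the leading block of
  \<open>x\<close>, which is zero only at the zero vector.\<close>

lemma gen_stein_isotropic_imp_leading_zero:
  assumes m: "m > 0" and k: "k > 0" and A: "A \<in> carrier_mat m (m * k)"
    and U: "U \<in> carrier_mat (m * k) (m * k)" "sym_block_toeplitz m (k - 1) U"
    and psd: "pos_semidef_mat (gen_stein_transform m k A U)"
    and pd: "pos_def_mat (stein_block m A U)"
    and x: "x \<in> carrier_vec (m * k)" and iso: "x \<bullet> (gen_stein_transform m k A U *\<^sub>v x) = 0"
    and "a < m"
  shows "x $ a = 0"
proof -
  let ?n = "m * k" and ?Q = "gen_stein_transform m k A U"
  have mk: "m \<le> ?n" using k by (cases k) auto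
  have diag: "?Q $$ (c, c) = 0" if "c \<ge> m" "c < ?n" for c
    using index_gen_stein_transform_shift[OF m k U(1), of "c - m" "c - m" A]
      sym_block_toeplitz_shift[OF m k U(2), of "c - m" "c - m"] that by simp
  have col: "?Q $$ (r, c) = 0" if "c \<ge> m" "c < ?n" "r < ?n" for r c
    using pos_semidef_diag_zero[OF psd gen_stein_transform_carrier] diag that by blast
  have row: "?Q $$ (c, r) = 0" if "c \<ge> m" "c < ?n" "r < ?n" for r c
  proof -
    have "?Q $$ (c, r) = ?Q\<^sup>T $$ (c, r)" using psd by (simp add: pos_semidef_mat_def)
    also have "\<dots> = ?Q $$ (r, c)" using that by simp
    finally show ?thesis using col that by simp
  qed
  define y where "y = vec m (\<lambda>a. x $ a)"
  have y: "y \<in> carrier_vec m" by (simp add: y_def)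
  have SB: "stein_block m A U = mat_block m ?Q 0 0"
    using stein_block_eq_upper_left[OF A _ U(1)] k by simp
  have SBc: "stein_block m A U \<in> carrier_mat m m" unfolding SB by (simp add: mat_block_def)
  have "0 = (\<Sum>i<?n. \<Sum>j<?n. x $ i * ?Q $$ (i, j) * x $ j)"
    using iso quadratic_form_sum[OF gen_stein_transform_carrier x] by simp
  also have "\<dots> = (\<Sum>i<m. \<Sum>j<?n. x $ i * ?Q $$ (i, j) * x $ j)"
    using mk row by (intro sum.mono_neutral_right) auto
  also have "\<dots> = (\<Sum>i<m. \<Sum>j<m. x $ i * ?Q $$ (i, j) * x $ j)"
    using mk col by (intro sum.cong sum.mono_neutral_right) auto
  also have "\<dots> = y \<bullet> (stein_block m A U *\<^sub>v y)"
    unfolding quadratic_form_sum[OF SBc y] by (intro sum.cong) (auto simp: SB y_def mat_block_def)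
  finally have "y = 0\<^sub>v m"
    using pd SBc y unfolding pos_def_mat_def by fastforce
  then have "y $ a = 0" using \<open>a < m\<close> by simp
  then show ?thesis using \<open>a < m\<close> by (simp add: y_def)
qed

text \<open>Moving \<open>B\<close> across the scalar product transposes it, so the Stein transform
  measures the drop of the form of \<open>U\<close> under one step of the transposed companion
  matrix.\<close>

lemma gen_stein_quadratic_form:
  assumes U: "U \<in> carrier_mat (m * k) (m * k)" and x: "x \<in> carrier_vec (m * k)"
  shows "x \<bullet> (gen_stein_transform m k A U *\<^sub>v x) = x \<bullet> (U *\<^sub>v x) -
    ((block_companion m k A)\<^sup>T *\<^sub>v x) \<bullet> (U *\<^sub>v ((block_companion m k A)\<^sup>T *\<^sub>v x))"
proof -
  let ?n = "m * k" and ?B = "block_companion m k A"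
  have B: "?B \<in> carrier_mat ?n ?n" "?B\<^sup>T \<in> carrier_mat ?n ?n" by auto
  let ?y = "?B\<^sup>T *\<^sub>v x"
  have y: "?y \<in> carrier_vec ?n" "U *\<^sub>v ?y \<in> carrier_vec ?n" using mult_mat_vec_carrier[OF U] by simp_all
  have BU: "?B * U \<in> carrier_mat ?n ?n" using B(1) U by (rule mult_carrier_mat)
  have "gen_stein_transform m k A U *\<^sub>v x = U *\<^sub>v x - (?B * U * ?B\<^sup>T) *\<^sub>v x"
    unfolding gen_stein_transform_def
    by (rule minus_mult_distrib_mat_vec) (use U x B BU in auto)
  also have "(?B * U * ?B\<^sup>T) *\<^sub>v x = ?B *\<^sub>v (U *\<^sub>v ?y)"
    by (simp only: assoc_mult_mat_vec[OF BU B(2) x] assoc_mult_mat_vec[OF B(1) U y(1)])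
  also have "x \<bullet> (U *\<^sub>v x - ?B *\<^sub>v (U *\<^sub>v ?y)) = x \<bullet> (U *\<^sub>v x) - x \<bullet> (?B *\<^sub>v (U *\<^sub>v ?y))"
    by (rule scalar_prod_minus_distrib[OF x mult_mat_vec_carrier[OF U x] mult_mat_vec_carrier[OF B(1) y(2)]])
  also have "x \<bullet> (?B *\<^sub>v (U *\<^sub>v ?y)) = ?y \<bullet> (U *\<^sub>v ?y)"
    using transpose_vec_mult_scalar[OF B(1) y(2) x] by simp
  finally show ?thesis .
qed

lemma eigenvalue_transpose:
  fixes M :: "'a :: field mat"
  assumes "M \<in> carrier_mat n n"
  shows "eigenvalue M\<^sup>T z \<longleftrightarrow> eigenvalue M z"
  using assms by (simp add: eigenvalue_root_char_poly[of _ n])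

text \<open>A left eigenvector of the companion matrix is handled through its real and imaginary
  parts \<open>p\<close> and \<open>q\<close>, which span an invariant plane of the transposed matrix.\<close>

lemma schur_stable_if_stein:
  assumes m: "m > 0" and k: "k > 0" and A: "A \<in> carrier_mat m (m * k)"
    and T: "sym_block_toeplitz m (k - 1) U" and UP: "pos_def_mat U"
    and psd: "pos_semidef_mat (gen_stein_transform m k A U)"
    and pd: "pos_def_mat (stein_block m A U)"
  shows "schur_stable m k A"
  unfolding schur_stable_def
proof (intro allI impI, rule ccontr)
  let ?n = "m * k" and ?B = "block_companion m k A"
  let ?BC = "map_mat complex_of_real ?B" and ?Q = "gen_stein_transform m k A U"
  fix z assume "det (mat_poly_eval m k A z) = 0" and nlt: "\<not> cmod z < 1"
  have U: "U \<in> carrier_mat ?n ?n"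
    using T block_toeplitz_carrier[OF k] by (auto simp: sym_block_toeplitz_def)
  have Bc: "?BC \<in> carrier_mat ?n ?n" by simp
  \<comment> \<open>The drop formula involves the transpose, so a left eigenvector is taken;
    transposition preserves eigenvalues.\<close>
  have "eigenvalue ?BC\<^sup>T z"
    using \<open>det (mat_poly_eval m k A z) = 0\<close> eigenvalue_block_companion_iff[OF m k]
    by (simp add: eigenvalue_transpose[OF Bc])
  then obtain v where v: "v \<in> carrier_vec ?n" "v \<noteq> 0\<^sub>v ?n" "?BC\<^sup>T *\<^sub>v v = z \<cdot>\<^sub>v v"
    unfolding eigenvalue_def eigenvector_def by auto
  define p q where "p = map_vec Re v" and "q = map_vec Im v"
  have pq: "p \<in> carrier_vec ?n" "q \<in> carrier_vec ?n" using v by (auto simp: p_def q_def)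
  have act: "(?B\<^sup>T *\<^sub>v x) $ i = (\<Sum>j<?n. ?B $$ (j, i) * x $ j)" if "x \<in> carrier_vec ?n" "i < ?n" for x i
    using index_mult_mat_vec_sum[of "?B\<^sup>T" ?n ?n x i] that by simp
  have ev: "(\<Sum>j<?n. complex_of_real (?B $$ (j, i)) * v $ j) = z * v $ i" if "i < ?n" for i
    using index_mult_mat_vec_sum[of "?BC\<^sup>T" ?n ?n v i] v that by simp
  have Bp: "(?B\<^sup>T *\<^sub>v p) $ i = Re z * p $ i - Im z * q $ i" if "i < ?n" for i
    using arg_cong[OF ev[OF that], of Re] act[OF pq(1) that] v(1) that by (simp add: p_def q_def)
  have Bq: "(?B\<^sup>T *\<^sub>v q) $ i = Im z * p $ i + Re z * q $ i" if "i < ?n" for i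
    using arg_cong[OF ev[OF that], of Im] act[OF pq(2) that] v(1) that by (simp add: p_def q_def)
  let ?u = "p \<bullet> (U *\<^sub>v p) + q \<bullet> (U *\<^sub>v q)"
  have B': "?B\<^sup>T *\<^sub>v p \<in> carrier_vec ?n" "?B\<^sup>T *\<^sub>v q \<in> carrier_vec ?n" by auto
  \<comment> \<open>The mixed terms in \<open>p\<close> and \<open>q\<close> cancel only when both
    forms are added, leaving the factor |z|^2.\<close>
  have "(?B\<^sup>T *\<^sub>v p) \<bullet> (U *\<^sub>v (?B\<^sup>T *\<^sub>v p)) + (?B\<^sup>T *\<^sub>v q) \<bullet> (U *\<^sub>v (?B\<^sup>T *\<^sub>v q)) =
    ((Re z)\<^sup>2 + (Im z)\<^sup>2) * ?u"
    unfolding quadratic_form_sum[OF U pq(1)] quadratic_form_sum[OF U pq(2)]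
      quadratic_form_sum[OF U B'(1)] quadratic_form_sum[OF U B'(2)]
      sum.distrib[symmetric] sum_distrib_left
    by (intro sum.cong refl) (simp add: Bp Bq algebra_simps power2_eq_square del: index_mult_mat_vec)
  then have total: "p \<bullet> (?Q *\<^sub>v p) + q \<bullet> (?Q *\<^sub>v q) = (1 - (cmod z)\<^sup>2) * ?u"
    unfolding gen_stein_quadratic_form[OF U pq(1)] gen_stein_quadratic_form[OF U pq(2)]
    by (simp add: cmod_power2 algebra_simps)
  have Upos: "x \<bullet> (U *\<^sub>v x) \<ge> 0" if "x \<in> carrier_vec ?n" for x
    using UP U that by (cases "x = 0\<^sub>v ?n") (auto simp: pos_def_mat_def intro: less_imp_le)
  \<comment> \<open>Two nonnegative numbers whose sum is at most zero: both \<open>p\<close> and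
    \<open>q\<close> are isotropic for \<open>?Q\<close>.\<close>
  have "1 \<le> (cmod z)\<^sup>2" using nlt by simp
  then have "(1 - (cmod z)\<^sup>2) * ?u \<le> 0"
    using Upos[OF pq(1)] Upos[OF pq(2)] by (intro mult_nonpos_nonneg) auto
  moreover have "p \<bullet> (?Q *\<^sub>v p) \<ge> 0" "q \<bullet> (?Q *\<^sub>v q) \<ge> 0"
    using psd pq by (auto simp: pos_semidef_mat_def)
  ultimately have "p \<bullet> (?Q *\<^sub>v p) = 0" "q \<bullet> (?Q *\<^sub>v q) = 0" using total by linarith+
  then have lead: "p $ a = 0" "q $ a = 0" if "a < m" for a
    using gen_stein_isotropic_imp_leading_zero[OF m k A U T psd pd] pq that by blast+
  \<comment> \<open>The real span of \<open>p\<close> and \<open>q\<close>, written by coordinates.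
    It inherits the zero leading block and is invariant, so observability forces \<open>p\<close>,
    \<open>q\<close> and hence \<open>v\<close> to vanish.\<close>
  define W where "W = {x \<in> carrier_vec ?n. \<exists>s t. \<forall>i<?n. x $ i = s * p $ i + t * q $ i}"
  have mk: "a < ?n" if "a < m" for a using k that by (cases k) auto
  have zero: "x = 0\<^sub>v ?n" if "x \<in> W" for x
  proof (rule block_companion_observable[OF m k _ _ _ that])
    show "W \<subseteq> carrier_vec ?n" by (auto simp: W_def)
    show "x $ a = 0" if "x \<in> W" "a < m" for x a
      using that lead mk by (auto simp: W_def)
    show "?B\<^sup>T *\<^sub>v x \<in> W" if "x \<in> W" for x
    proof -
      obtain s t where x: "x \<in> carrier_vec ?n" "\<And>i. i < ?n \<Longrightarrow> x $ i = s * p $ i + t * q $ i"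
        using \<open>x \<in> W\<close> by (auto simp: W_def)
      have "(?B\<^sup>T *\<^sub>v x) $ i = (s * Re z + t * Im z) * p $ i + (t * Re z - s * Im z) * q $ i"
        if "i < ?n" for i
      proof -
        have "(?B\<^sup>T *\<^sub>v x) $ i = s * (?B\<^sup>T *\<^sub>v p) $ i + t * (?B\<^sup>T *\<^sub>v q) $ i"
          unfolding act[OF x(1) that] act[OF pq(1) that] act[OF pq(2) that]
          by (simp add: x(2) algebra_simps sum.distrib sum_distrib_left)
        then show ?thesis unfolding Bp[OF that] Bq[OF that] by (simp add: algebra_simps)
      qed
      moreover have "?B\<^sup>T *\<^sub>v x \<in> carrier_vec ?n" by auto
      ultimately show ?thesis unfolding W_def by blast
    qed
  qed
  have "\<forall>i<?n. p $ i = 1 * p $ i + 0 * q $ i" by simp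
  then have "p \<in> W" unfolding W_def using pq(1) by blast
  moreover have "\<forall>i<?n. q $ i = 0 * p $ i + 1 * q $ i" by simp
  then have "q \<in> W" unfolding W_def using pq(2) by blast
  ultimately have pq0: "p = 0\<^sub>v ?n" "q = 0\<^sub>v ?n" using zero by auto
  have "v = 0\<^sub>v ?n"
  proof (rule eq_vecI)
    fix i assume "i < dim_vec (0\<^sub>v ?n :: complex vec)"
    then have i: "i < ?n" by simp
    have "Re (v $ i) = p $ i" "Im (v $ i) = q $ i" using v(1) i by (auto simp: p_def q_def)
    then show "v $ i = 0\<^sub>v ?n $ i" using pq0 i by (simp add: complex_eq_iff)
  qed (use v in simp)
  with v show False by simp
qed

section \<open>Necessity: the certificate as a convergent series\<close>

lemma pow_mat_Suc_left:
  assumes M: "M \<in> carrier_mat n n"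
  shows "M ^\<^sub>m Suc i = M * M ^\<^sub>m i"
proof (induction i)
  case (Suc i)
  have "M ^\<^sub>m Suc (Suc i) = (M * M ^\<^sub>m i) * M" using Suc by simp
  also have "\<dots> = M * (M ^\<^sub>m i * M)" using M by (intro assoc_mult_mat) auto
  finally show ?case by simp
qed (use M in simp)

lemma index_conjugate_mat:
  fixes B U :: "'a :: comm_ring_1 mat"
  assumes "B \<in> carrier_mat n n" "U \<in> carrier_mat n n" "r < n" "c < n"
  shows "(B * U * B\<^sup>T) $$ (r, c) = (\<Sum>a<n. \<Sum>b<n. B $$ (r, a) * U $$ (a, b) * B $$ (c, b))"
proof -
  have "(B * U * B\<^sup>T) $$ (r, c) = (\<Sum>a<n. B $$ (r, a) * (\<Sum>b<n. U $$ (a, b) * B $$ (c, b)))"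
    using assms by (auto simp: scalar_prod_def atLeast0LessThan intro!: sum.cong)
  then show ?thesis by (simp add: sum_distrib_left mult.assoc)
qed

text \<open>Exhibits the form of each term of the series as a sum of squares, which yields
  semidefiniteness and, later, the vanishing of each square.\<close>

lemma gram_quadratic_form:
  fixes P :: "nat \<Rightarrow> nat \<Rightarrow> 'a :: comm_ring_1"
  shows "(\<Sum>i<n. \<Sum>j<n. x i * (\<Sum>a<m. P i a * P j a) * x j) = (\<Sum>a<m. (\<Sum>i<n. P i a * x i)\<^sup>2)"
proof -
  have "(\<Sum>i<n. \<Sum>j<n. x i * (\<Sum>a<m. P i a * P j a) * x j) =
    (\<Sum>i<n. \<Sum>j<n. \<Sum>a<m. (P i a * x i) * (P j a * x j))"
    by (simp add: sum_distrib_left sum_distrib_right mult_ac)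
  also have "\<dots> = (\<Sum>i<n. \<Sum>a<m. \<Sum>j<n. (P i a * x i) * (P j a * x j))"
    by (intro sum.cong refl sum.swap)
  also have "\<dots> = (\<Sum>a<m. \<Sum>i<n. \<Sum>j<n. (P i a * x i) * (P j a * x j))"
    by (rule sum.swap)
  finally show ?thesis by (simp add: power2_eq_square sum_product)
qed

lemma stein_if_schur_stable:
  assumes m: "m > 0" and k: "k > 0" and A: "A \<in> carrier_mat m (m * k)"
    and stable: "schur_stable m k A"
  shows "\<exists>U. sym_block_toeplitz m (k - 1) U \<and> pos_def_mat U \<and>
    pos_semidef_mat (gen_stein_transform m k A U) \<and> pos_def_mat (stein_block m A U)"
proof -
  let ?n = "m * k"
  define B where "B = block_companion m k A"
  have B: "B \<in> carrier_mat ?n ?n" by (simp add: B_def)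
  have Bpow: "B ^\<^sub>m i \<in> carrier_mat ?n ?n" for i using B by simp
  have mk: "a < ?n" if "a < m" for a using k that by (cases k) auto
  have n: "?n > 0" using m k by simp
  have "cmod z < 1" if "eigenvalue (map_mat complex_of_real B) z" for z
    using that stable eigenvalue_block_companion_iff[OF m k] by (auto simp: B_def schur_stable_def)
  then have "\<exists>C q. 0 < q \<and> q < 1 \<and> (\<forall>i r c. r < ?n \<longrightarrow> c < ?n \<longrightarrow>
      cmod ((map_mat complex_of_real B ^\<^sub>m i) $$ (r, c)) \<le> C * q ^ i)"
    using B n by (intro pow_mat_geometric_bound) auto
  then obtain C q where q: "0 < q" "q < 1" and bound:
    "\<And>i r c. r < ?n \<Longrightarrow> c < ?n \<Longrightarrow> cmod ((map_mat complex_of_real B ^\<^sub>m i) $$ (r, c)) \<le> C * q ^ i"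
    by blast
  have decay: "\<bar>(B ^\<^sub>m i) $$ (r, c)\<bar> \<le> C * q ^ i" if "r < ?n" "c < ?n" for i r c
  proof -
    have "(map_mat complex_of_real B ^\<^sub>m i) $$ (r, c) = complex_of_real ((B ^\<^sub>m i) $$ (r, c))"
      unfolding of_real_hom.mat_hom_pow[OF B, symmetric]
      using that carrier_matD[OF Bpow[of i]] by (intro index_map_mat) simp_all
    then show ?thesis using bound[OF that, of i] by simp
  qed
  \<comment> \<open>Entry (r, c) of \<open>B^i E (B^i)'\<close>; multiplication by \<open>E\<close>
    keeps only the first \<open>m\<close> columns of \<open>B^i\<close>, hence the range
    \<open>a < m\<close>.\<close>
  define G where "G i r c = (\<Sum>a<m. (B ^\<^sub>m i) $$ (r, a) * (B ^\<^sub>m i) $$ (c, a))" for i r c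
  define U where "U = mat ?n ?n (\<lambda>(r, c). \<Sum>i. G i r c)"
  have U: "U \<in> carrier_mat ?n ?n" by (simp add: U_def)
  have G_sums: "(\<lambda>i. G i r c) sums U $$ (r, c)" if rc: "r < ?n" "c < ?n" for r c
  proof -
    have G_bound: "norm (G i r c) \<le> (\<Sum>a<m. C\<^sup>2 * (q\<^sup>2) ^ i)" for i
      unfolding G_def
    proof (rule sum_norm_le)
      fix a assume "a \<in> {..<m}"
      then have "a < ?n" using mk by simp
      \<comment> \<open>The sign of \<open>C\<close> is not given; \<open>decay\<close> itself shows
        that \<open>C * q ^ i\<close> is nonnegative.\<close>
      then have "\<bar>(B ^\<^sub>m i) $$ (r, a)\<bar> * \<bar>(B ^\<^sub>m i) $$ (c, a)\<bar> \<le> (C * q ^ i) * (C * q ^ i)"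
        using rc by (intro mult_mono decay order_trans[OF abs_ge_zero decay[of r a]]) auto
      then show "norm ((B ^\<^sub>m i) $$ (r, a) * (B ^\<^sub>m i) $$ (c, a)) \<le> C\<^sup>2 * (q\<^sup>2) ^ i"
        by (simp add: abs_mult power2_eq_square power_mult_distrib mult_ac)
    qed
    have "summable (\<lambda>i. \<Sum>a<m. C\<^sup>2 * (q\<^sup>2) ^ i)"
      using q by (intro summable_sum summable_mult summable_geometric) (simp add: power_less_one_iff)
    then have "summable (\<lambda>i. G i r c)"
      by (rule summable_comparison_test'[where N = 0]) (rule G_bound)
    then show ?thesis using rc unfolding U_def by (simp add: summable_sums)
  qed
  have G_Suc: "G (Suc i) r c = (\<Sum>a<?n. \<Sum>b<?n. B $$ (r, a) * G i a b * B $$ (c, b))"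
    if rc: "r < ?n" "c < ?n" for i r c
  proof -
    have e: "(B ^\<^sub>m Suc i) $$ (s, d) = (\<Sum>a<?n. B $$ (s, a) * (B ^\<^sub>m i) $$ (a, d))"
      if "s < ?n" "d < m" for s d
      unfolding pow_mat_Suc_left[OF B] using B Bpow[of i] that mk
      by (auto simp: scalar_prod_def atLeast0LessThan intro!: sum.cong)
    have "G (Suc i) r c = (\<Sum>d<m. (\<Sum>a<?n. \<Sum>b<?n.
        B $$ (r, a) * (B ^\<^sub>m i) $$ (a, d) * (B $$ (c, b) * (B ^\<^sub>m i) $$ (b, d))))"
      unfolding G_def by (intro sum.cong refl) (use rc in \<open>simp add: e sum_product del: pow_mat.simps\<close>)
    also have "\<dots> = (\<Sum>a<?n. \<Sum>d<m. \<Sum>b<?n.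
        B $$ (r, a) * (B ^\<^sub>m i) $$ (a, d) * (B $$ (c, b) * (B ^\<^sub>m i) $$ (b, d)))"
      by (rule sum.swap)
    also have "\<dots> = (\<Sum>a<?n. \<Sum>b<?n. \<Sum>d<m.
        B $$ (r, a) * (B ^\<^sub>m i) $$ (a, d) * (B $$ (c, b) * (B ^\<^sub>m i) $$ (b, d)))"
      by (intro sum.cong refl sum.swap)
    also have "\<dots> = (\<Sum>a<?n. \<Sum>b<?n. B $$ (r, a) * G i a b * B $$ (c, b))"
      by (intro sum.cong refl) (simp add: G_def sum_distrib_left sum_distrib_right mult_ac)
    finally show ?thesis .
  qed
  have Q: "gen_stein_transform m k A U $$ (r, c) = G 0 r c" if rc: "r < ?n" "c < ?n" for r c
  proof -
    \<comment> \<open>By \<open>G_Suc\<close>, conjugation by \<open>B\<close> advances each term by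
      one, so \<open>B U B'\<close> is the series without its term of index 0, and the difference
      telescopes to \<open>G 0\<close>.\<close>
    have "(\<lambda>i. G (Suc i) r c) sums (\<Sum>a<?n. \<Sum>b<?n. B $$ (r, a) * U $$ (a, b) * B $$ (c, b))"
      unfolding G_Suc[OF rc] by (intro sums_sum sums_mult sums_mult2 G_sums) auto
    then have "(\<lambda>i. G i r c) sums ((B * U * B\<^sup>T) $$ (r, c) + G 0 r c)"
      unfolding index_conjugate_mat[OF B U rc] by (rule iffD1[OF sums_Suc_iff])
    then have "(B * U * B\<^sup>T) $$ (r, c) + G 0 r c = U $$ (r, c)"
      using G_sums[OF rc] by (rule sums_unique2)
    then show ?thesis
      using rc U B by (simp add: gen_stein_transform_def flip: B_def del: index_mult_mat(1))
  qed
  have G0: "G 0 r c = (if r = c \<and> r < m then 1 else 0)" if rc: "r < ?n" "c < ?n" for r c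
  proof -
    have "G 0 r c = (\<Sum>a<m. if a = r then (if r = c then 1 else 0) else 0)"
      unfolding G_def using rc mk B by (intro sum.cong) auto
    then show ?thesis by simp
  qed
  have Usym: "U\<^sup>T = U"
    by (rule eq_matI) (auto simp: U_def G_def mult.commute)
  have toeplitz: "sym_block_toeplitz m (k - 1) U"
  proof (rule sym_block_toeplitzI[OF m k U Usym])
    fix r c assume rc: "r + m < ?n" "c + m < ?n"
    then show "U $$ (r + m, c + m) = U $$ (r, c)"
      using index_gen_stein_transform_shift[OF m k U rc, of A] Q[OF rc] G0[OF rc] by simp
  qed
  \<comment> \<open>The squared norm of the leading block of \<open>(B^i)' x\<close>, which is the
    contribution of term \<open>i\<close> to the form of \<open>U\<close> at
    \<open>x\<close>.\<close>
  define g where "g x i = (\<Sum>a<m. (\<Sum>r<?n. (B ^\<^sub>m i) $$ (r, a) * x $ r)\<^sup>2)" for x :: "real vec" and i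
  have g: "(\<Sum>r<?n. \<Sum>c<?n. x $ r * G i r c * x $ c) = g x i" for x i
    unfolding G_def g_def by (rule gram_quadratic_form)
  have g_nonneg: "g x i \<ge> 0" for x i unfolding g_def by (intro sum_nonneg) simp
  have psd: "pos_semidef_mat (gen_stein_transform m k A U)"
    unfolding pos_semidef_mat_def
  proof (intro conjI ballI)
    let ?Q = "gen_stein_transform m k A U"
    note Qc = gen_stein_transform_carrier[of m k A U]
    show "?Q\<^sup>T = ?Q" by (rule eq_matI) (auto simp: Q G0)
    fix x :: "real vec" assume "x \<in> carrier_vec (dim_row ?Q)"
    then have x: "x \<in> carrier_vec ?n" by simp
    have "x \<bullet> (?Q *\<^sub>v x) = g x 0"
      unfolding quadratic_form_sum[OF Qc x] g[symmetric] by (intro sum.cong refl) (simp add: Q)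
    then show "x \<bullet> (?Q *\<^sub>v x) \<ge> 0" using g_nonneg by simp
  qed
  have "pos_def_mat U"
    unfolding pos_def_mat_def
  proof (intro conjI ballI impI Usym)
    fix x :: "real vec" assume "x \<in> carrier_vec (dim_row U)" "x \<noteq> 0\<^sub>v (dim_row U)"
    then have x: "x \<in> carrier_vec ?n" "x \<noteq> 0\<^sub>v ?n" using U by auto
    have sums: "g x sums (x \<bullet> (U *\<^sub>v x))"
      unfolding quadratic_form_sum[OF U x(1)] g[symmetric]
      by (intro sums_sum sums_mult sums_mult2 G_sums) auto
    show "0 < x \<bullet> (U *\<^sub>v x)"
    proof (rule ccontr)
      assume "\<not> 0 < x \<bullet> (U *\<^sub>v x)"
      then have le: "suminf (g x) \<le> 0" using sums_unique[OF sums] by simp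
      \<comment> \<open>A series of nonnegative terms with sum at most zero has only zero
        terms.\<close>
      have g0: "g x i = 0" for i
        using le suminf_eq_zero_iff[OF sums_summable[OF sums]] suminf_nonneg[OF sums_summable[OF sums]]
          g_nonneg by (metis antisym)
      \<comment> \<open>The orbit of \<open>x\<close> under the transposed companion matrix: it is
        invariant, and \<open>g0\<close> gives every member a zero leading block, so observability
        yields \<open>x = 0\<close>.\<close>
      define W where "W = range (\<lambda>i. (B ^\<^sub>m i)\<^sup>T *\<^sub>v x)"
      have "x = 0\<^sub>v ?n"
      proof (rule block_companion_observable[OF m k])
        show "W \<subseteq> carrier_vec ?n" using B by (auto simp: W_def intro!: carrier_vecI)
        show "x \<in> W" using x B by (auto simp: W_def intro!: image_eqI[of _ _ 0])
        show "y $ a = 0" if y: "y \<in> W" and a: "a < m" for y a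
        proof -
          obtain i where i: "y = (B ^\<^sub>m i)\<^sup>T *\<^sub>v x" using y by (auto simp: W_def)
          have "y $ a = (\<Sum>r<?n. (B ^\<^sub>m i) $$ (r, a) * x $ r)"
            unfolding i using index_mult_mat_vec_sum[of "(B ^\<^sub>m i)\<^sup>T" ?n ?n x a] B x a mk by simp
          moreover have "(\<Sum>r<?n. (B ^\<^sub>m i) $$ (r, a) * x $ r)\<^sup>2 = 0"
            using g0[of i] a unfolding g_def by (subst (asm) sum_nonneg_eq_0_iff) auto
          ultimately show ?thesis by simp
        qed
        show "(block_companion m k A)\<^sup>T *\<^sub>v y \<in> W" if y: "y \<in> W" for y
        proof -
          obtain i where i: "y = (B ^\<^sub>m i)\<^sup>T *\<^sub>v x" using y by (auto simp: W_def)
          have "B\<^sup>T *\<^sub>v y = (B ^\<^sub>m Suc i)\<^sup>T *\<^sub>v x"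
            unfolding i using B Bpow[of i] x
            by (simp add: transpose_mult[OF Bpow[of i] B] assoc_mult_mat_vec[of "B\<^sup>T" ?n ?n _ ?n])
          then show ?thesis unfolding W_def B_def by blast
        qed
      qed
      with x show False by simp
    qed
  qed
  \<comment> \<open>The leading block of \<open>E\<close>.\<close>
  moreover have "stein_block m A U = 1\<^sub>m m"
    unfolding stein_block_eq_upper_left[OF A Suc_leI[OF k, folded One_nat_def] U]
    by (rule eq_matI) (use mk in \<open>auto simp: mat_block_def Q G0\<close>)
  moreover have "pos_def_mat (1\<^sub>m m)"
    unfolding pos_def_mat_def
  proof (intro conjI ballI impI)
    fix x :: "real vec" assume "x \<in> carrier_vec (dim_row (1\<^sub>m m :: real mat))" "x \<noteq> 0\<^sub>v (dim_row (1\<^sub>m m :: real mat))"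
    then have x: "x \<in> carrier_vec m" "x \<noteq> 0\<^sub>v m" by auto
    then have "x \<bullet> x > 0" using conjugate_square_greater_0_vec[of x m] by simp
    then show "0 < x \<bullet> (1\<^sub>m m *\<^sub>v x)" using x by simp
  qed simp
  ultimately show ?thesis using toeplitz psd by auto
qed

theorem theorem4p3:
  fixes m k :: nat and A :: "real mat"
  assumes "m \<ge> 1" and "k \<ge> 1" and "A \<in> carrier_mat m (m * k)"
  shows "schur_stable m k A \<longleftrightarrow>
    (\<exists>U. sym_block_toeplitz m (k - 1) U \<and> pos_def_mat U \<and>
         pos_semidef_mat (gen_stein_transform m k A U) \<and>
         pos_def_mat (stein_block m A U))"
proof -
  have "m > 0" "k > 0" using assms by auto
  then show ?thesis
    using schur_stable_if_stein stein_if_schur_stable assms(3) by blast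
qed

end
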